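(* Let $G=(\mathcal{V},\mathcal{E})$ be a finite undirected graph with finite nonnegative edge capacities $c_e$, $e\in\mathcal{E}$, and let $s,t,d\in\mathcal{V}$ be distinct nodes. Let $F_{s,d}^t$ be the maximum flow from $s$ to $d$ with must-stop node $t$. Let $F_{s,t}$ and $F_{t,d}$ be the (standard) maximum flow values in $G$ between $s$ and $t$ and between $t$ and $d$, respectively. Let $F_{t,T}$ be the (standard) maximum flow value from $t$ to $T$ in the graph obtained from $G$ by adding a new node $T$ joined to $s$ and to $d$ by edges of infinite capacity. Then $$F_{s,d}^t=\min\{F_{t,T}/2,\ F_{s,t},\ F_{t,d}\}.$$
   Context: In an undirected capacitated graph, an edge can carry flow in either direction, but the total flow on the edge, summed over both directions, cannot exceed its capacity. Let $\mathcal{P}_{st}$ (resp. $\mathcal{P}_{td}$) be the set of all paths in $G$ between $s$ and $t$ (resp. between $t$ and $d$). The maximum flow with one must-stop node $t$, $F_{s,d}^t$, is the maximum amount of flow that can be sent simultaneously from $s$ to $t$ over $\mathcal{P}_{st}$ and from $t$ to $d$ over $\mathcal{P}_{td}$. That is, it is the maximum $\lambda$ for which there exist $x_p\ge 0$ for $p\in\mathcal{P}_{st}$ and $y_q\ge 0$ for $q\in\mathcal{P}_{td}$ with $$\sum_{p\in\mathcal{P}_{st}}x_p\ge\lambda,\qquad \sum_{q\in\mathcal{P}_{td}}y_q\ge\lambda,\qquad \sum_{p\in\mathcal{P}_{st}:\,e\in p}x_p+\sum_{q\in\mathcal{P}_{td}:\,e\in q}y_q\le c_e\quad\text{for all }e\in\mathcal{E}.$$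 Flows may be fractional. *)

theory Defs
  imports Complex_Main "HOL-Library.Extended_Real"
begin

text \<open>
  An undirected graph is given by its vertex set \<open>V\<close> and its set \<open>E\<close> of edges, each edge being
  the two-element set of its end vertices.
\<close>

definition undirected_graph :: "'v set \<Rightarrow> 'v set set \<Rightarrow> bool" where
  "undirected_graph V E \<longleftrightarrow> finite V \<and> (\<forall>e\<in>E. e \<subseteq> V \<and> card e = 2)"

text \<open>
  \<open>f u v\<close> is the amount sent along the edge \<open>{u, v}\<close> in the direction from \<open>u\<close> to \<open>v\<close>. Both
  directions may be used at once and share the capacity of the edge. Capacities are extended
  reals so that infinite ones are allowed.
\<close>

definition is_flow ::
  "'v set \<Rightarrow> 'v set set \<Rightarrow> ('v set \<Rightarrow> ereal) \<Rightarrow> 'v \<Rightarrow> 'v \<Rightarrow> ('v \<Rightarrow> 'v \<Rightarrow> real) \<Rightarrow> bool" where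
  "is_flow V E c a b f \<longleftrightarrow>
     (\<forall>u v. 0 \<le> f u v) \<and>
     (\<forall>u v. {u, v} \<notin> E \<longrightarrow> f u v = 0) \<and>
     (\<forall>u v. {u, v} \<in> E \<longrightarrow> ereal (f u v + f v u) \<le> c {u, v}) \<and>
     (\<forall>v\<in>V - {a, b}. (\<Sum>u\<in>V. f u v) = (\<Sum>u\<in>V. f v u))"

definition flow_value :: "'v set \<Rightarrow> 'v \<Rightarrow> ('v \<Rightarrow> 'v \<Rightarrow> real) \<Rightarrow> real" where
  "flow_value V a f = (\<Sum>v\<in>V. f a v) - (\<Sum>v\<in>V. f v a)"

definition max_flow :: "'v set \<Rightarrow> 'v set set \<Rightarrow> ('v set \<Rightarrow> ereal) \<Rightarrow> 'v \<Rightarrow> 'v \<Rightarrow> real" where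
  "max_flow V E c a b = (GREATEST r. \<exists>f. is_flow V E c a b f \<and> r = flow_value V a f)"

text \<open>
  Paths do not repeat vertices and are represented by their vertex sequence. For \<open>a \<noteq> b\<close>,
  reading every path between \<open>a\<close> and \<open>b\<close> from \<open>a\<close> to \<open>b\<close> makes this representation unique.
\<close>

definition path_edges :: "'v list \<Rightarrow> 'v set set" where
  "path_edges p = {{p ! i, p ! Suc i} | i. Suc i < length p}"

definition paths :: "'v set \<Rightarrow> 'v set set \<Rightarrow> 'v \<Rightarrow> 'v \<Rightarrow> 'v list set" where
  "paths V E a b = {p. p \<noteq> [] \<and> hd p = a \<and> last p = b \<and> distinct p \<and>
                       set p \<subseteq> V \<and> path_edges p \<subseteq> E}"

definition must_stop_feasible ::
  "'v set \<Rightarrow> 'v set set \<Rightarrow> ('v set \<Rightarrow> real) \<Rightarrow> 'v \<Rightarrow> 'v \<Rightarrow> 'v \<Rightarrow> real \<Rightarrow> bool" where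
  "must_stop_feasible V E c s t d r \<longleftrightarrow>
     (\<exists>x y. (\<forall>p\<in>paths V E s t. 0 \<le> x p) \<and>
            (\<forall>q\<in>paths V E t d. 0 \<le> y q) \<and>
            (\<Sum>p\<in>paths V E s t. x p) \<ge> r \<and>
            (\<Sum>q\<in>paths V E t d. y q) \<ge> r \<and>
            (\<forall>e\<in>E. (\<Sum>p\<in>{p \<in> paths V E s t. e \<in> path_edges p}. x p)
                  + (\<Sum>q\<in>{q \<in> paths V E t d. e \<in> path_edges q}. y q) \<le> c e))"

definition max_must_stop_flow ::
  "'v set \<Rightarrow> 'v set set \<Rightarrow> ('v set \<Rightarrow> real) \<Rightarrow> 'v \<Rightarrow> 'v \<Rightarrow> 'v \<Rightarrow> real" where
  "max_must_stop_flow V E c s t d = (GREATEST r. must_stop_feasible V E c s t d r)"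

text \<open>
  Adding a new node joined to \<open>s\<close> and \<open>d\<close> by edges of infinite capacity: \<open>None\<close> is the new node
  and \<open>Some v\<close> is the old node \<open>v\<close>. The argument of \<open>c\<close> below is the old edge underlying \<open>e\<close>.
\<close>

definition ext_verts :: "'v set \<Rightarrow> 'v option set" where
  "ext_verts V = insert None (Some ` V)"

definition ext_edges :: "'v set set \<Rightarrow> 'v \<Rightarrow> 'v \<Rightarrow> 'v option set set" where
  "ext_edges E s d = (\<lambda>e. Some ` e) ` E \<union> {{Some s, None}, {Some d, None}}"

definition ext_cap :: "('v set \<Rightarrow> real) \<Rightarrow> 'v option set \<Rightarrow> ereal" where
  "ext_cap c e = (if None \<in> e then \<infinity> else ereal (c (Some -` e)))"

end

theory Submission
  imports Defs "HOL-Analysis.Function_Topology"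
begin

text \<open>
  Only the net amount sent along an edge matters, so all flows are treated as skew-symmetric
  functions on the vertices of \<open>G\<close>; a flow from \<open>t\<close> to \<open>T\<close> in the extended graph is then a net
  flow in \<open>G\<close> conserved off \<open>{s, t, d}\<close>. Let \<open>r\<close> be the claimed minimum. Among the net flows
  delivering at most \<open>r\<close> to each of \<open>s\<close> and \<open>d\<close> pick one with maximal total. If, say, \<open>s\<close> receives
  less than \<open>r\<close>, then \<open>s\<close> is not reachable from \<open>t\<close> in the residual graph, and the unreachable
  vertices form a saturated cut, through which no other net flow delivers more: if \<open>d\<close> is
  unreachable too, this contradicts the flow of value \<open>2 r\<close> to \<open>T\<close>, or else the flow of value \<open>r\<close>
  to \<open>s\<close>. So \<open>s\<close> and \<open>d\<close> both receive \<open>r\<close>, and a path decomposition yields the must-stop flow.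
\<close>

section \<open>Net flows\<close>

definition net :: "('v \<Rightarrow> 'v \<Rightarrow> real) \<Rightarrow> 'v \<Rightarrow> 'v \<Rightarrow> real" where
  "net f u v = f u v - f v u"

text \<open>For skew \<open>g\<close> this is the net excess at \<open>v\<close>, arriving minus
  leaving, so conservation at \<open>v\<close> reads \<open>inflow V g v = 0\<close>.\<close>

definition inflow :: "'v set \<Rightarrow> ('v \<Rightarrow> 'v \<Rightarrow> real) \<Rightarrow> 'v \<Rightarrow> real" where
  "inflow V g v = (\<Sum>u\<in>V. g u v)"

lemma inflow_add: "inflow V (\<lambda>u v. g u v + h u v) w = inflow V g w + inflow V h w"
  by (simp add: inflow_def sum.distrib)

lemma inflow_diff: "inflow V (\<lambda>u v. g u v - h u v) w = inflow V g w - inflow V h w"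
  by (simp add: inflow_def sum_subtractf)

lemma inflow_minus: "inflow V (\<lambda>u v. - g u v) w = - inflow V g w"
  by (simp add: inflow_def sum_negf)

lemma inflow_scale: "inflow V (\<lambda>u v. r * g u v) w = r * inflow V g w"
  by (simp add: inflow_def sum_distrib_left)

lemma inflow_net: "inflow V (net f) v = (\<Sum>u\<in>V. f u v) - (\<Sum>u\<in>V. f v u)"
  by (simp add: inflow_def net_def sum_subtractf)

lemma net_diff: "net (\<lambda>u v. f u v - h u v) = (\<lambda>u v. net f u v - net h u v)"
  by (simp add: net_def fun_eq_iff)

definition skew :: "('v \<Rightarrow> 'v \<Rightarrow> real) \<Rightarrow> bool" where
  "skew g \<longleftrightarrow> (\<forall>u v. g u v = - g v u)"

lemma skewI: "(\<And>u v. g u v = - g v u) \<Longrightarrow> skew g"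
  unfolding skew_def by blast

lemma skewD: "skew g \<Longrightarrow> g u v = - g v u"
  unfolding skew_def by blast

lemma skew_net: "skew (net f)"
  by (rule skewI) (simp add: net_def)

lemma skew_minus:
  assumes "skew g"
  shows "skew (\<lambda>u v. - g u v)"
proof (rule skewI)
  show "- g u v = - (- g v u)" for u v
    using skewD[OF assms, of u v] by linarith
qed

lemma skew_add:
  assumes "skew g" and "skew h"
  shows "skew (\<lambda>u v. g u v + h u v)"
proof (rule skewI)
  show "g u v + h u v = - (g v u + h v u)" for u v
    using skewD[OF assms(1), of u v] skewD[OF assms(2), of u v] by linarith
qed

lemma skew_scale:
  assumes "skew g"
  shows "skew (\<lambda>u v. r * g u v)"
proof (rule skewI)
  show "r * g u v = - (r * g v u)" for u v
    using skewD[OF assms, of u v] by simp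
qed

lemma sum_skew_eq_0:
  assumes "skew g"
  shows "(\<Sum>v\<in>S. \<Sum>u\<in>S. g u v) = 0"
proof -
  have "(\<Sum>v\<in>S. \<Sum>u\<in>S. g u v) = (\<Sum>v\<in>S. \<Sum>u\<in>S. g v u)"
    by (rule sum.swap)
  also have "\<dots> = - (\<Sum>v\<in>S. \<Sum>u\<in>S. g u v)"
    unfolding sum_negf[symmetric] by (intro sum.cong refl) (rule skewD[OF assms])
  finally show ?thesis by simp
qed

text \<open>Flow between two vertices of \<open>S\<close> cancels by skewness, so only what crosses
  from \<open>V - S\<close> counts. For \<open>S = V\<close> nothing crosses and the total excess is
  zero.\<close>

lemma sum_inflow_cut:
  assumes "finite V" and "S \<subseteq> V" and "skew g"
  shows "(\<Sum>v\<in>S. inflow V g v) = (\<Sum>v\<in>S. \<Sum>u\<in>V - S. g u v)"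
proof -
  have "inflow V g v = (\<Sum>u\<in>V - S. g u v) + (\<Sum>u\<in>S. g u v)" for v
    unfolding inflow_def using assms by (intro sum.subset_diff)
  then show ?thesis
    using sum_skew_eq_0[of g S, OF assms(3)] by (simp add: sum.distrib)
qed

section \<open>Net flows within the capacities of a graph, and existence of maximal ones\<close>

locale capacitated_graph =
  fixes V :: "'v set" and E :: "'v set set" and c :: "'v set \<Rightarrow> real"
  assumes graph: "undirected_graph V E"
    and cap_nonneg: "\<And>e. e \<in> E \<Longrightarrow> 0 \<le> c e"
begin

lemma finite_V: "finite V"
  using graph by (simp add: undirected_graph_def)

lemma edgeD: "{u, v} \<in> E \<Longrightarrow> u \<in> V \<and> v \<in> V \<and> u \<noteq> v"
  using graph by (fastforce simp: undirected_graph_def)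

text \<open>Being zero off the edges, it lets one inequality express both the capacity bound and the
  absence of flow on non-edges.\<close>

definition cap :: "'v \<Rightarrow> 'v \<Rightarrow> real" where
  "cap u v = (if {u, v} \<in> E then c {u, v} else 0)"

lemma cap_commute: "cap u v = cap v u"
  by (simp add: cap_def insert_commute)

lemma cap_ge_0: "0 \<le> cap u v"
  by (simp add: cap_def cap_nonneg)

text \<open>Cancelling opposite amounts on an edge changes no excess and only lowers its load, so a
  capacity shared by both directions becomes a bound on the absolute net amount.\<close>

definition netflow :: "('v \<Rightarrow> 'v \<Rightarrow> real) \<Rightarrow> bool" where
  "netflow g \<longleftrightarrow> skew g \<and> (\<forall>u v. \<bar>g u v\<bar> \<le> cap u v)"

lemma netflow_skew: "netflow g \<Longrightarrow> skew g"
  by (simp add: netflow_def)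

lemma netflow_le_cap: "netflow g \<Longrightarrow> g u v \<le> cap u v"
  by (simp add: netflow_def abs_le_iff)

lemma netflowI:
  assumes "skew g" and "\<And>u v. g u v \<le> cap u v"
  shows "netflow g"
proof -
  have "\<bar>g u v\<bar> \<le> cap u v" for u v
    using assms(2)[of u v] assms(2)[of v u] skewD[OF assms(1), of u v] cap_commute[of u v]
    by linarith
  then show ?thesis
    using assms(1) by (simp add: netflow_def)
qed

lemma netflow_0: "netflow (\<lambda>u v. 0)"
  by (simp add: netflowI skewI cap_ge_0)

lemma netflow_minus: "netflow g \<Longrightarrow> netflow (\<lambda>u v. - g u v)"
  by (simp add: netflow_def skew_minus)

lemma netflow_nonedge: "netflow g \<Longrightarrow> {u, v} \<notin> E \<Longrightarrow> g u v = 0"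
  unfolding netflow_def cap_def by (metis abs_le_zero_iff)

text \<open>Tychonoff's theorem makes the set of net flows compact, even if the vertex type is infinite.\<close>

lemma max_netflow_exists:
  assumes "\<And>v. closed (A v)" and "\<And>v. 0 \<in> A v"
  obtains g where "netflow g" and "\<And>v. v \<in> V \<Longrightarrow> inflow V g v \<in> A v"
    and "\<And>g'. netflow g' \<Longrightarrow> (\<And>v. v \<in> V \<Longrightarrow> inflow V g' v \<in> A v) \<Longrightarrow>
           (\<Sum>v\<in>W. inflow V g' v) \<le> (\<Sum>v\<in>W. inflow V g v)"
proof -
  \<comment> \<open>Flows become functions on pairs: \<open>B\<close> is a product of compact
    intervals carrying the capacity bounds, and \<open>N\<close> collects the closed conditions of
    skewness and admissible excess.\<close>
  define B where "B = (\<Pi>\<^sub>E i\<in>UNIV. case i of (u, v) \<Rightarrow> {- cap u v .. cap u v})"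
  define N where "N = {G. \<forall>u v. G (u, v) = - G (v, u)} \<inter>
    {G. \<forall>v\<in>V. inflow V (curry G) v \<in> A v}"
  have cont: "continuous_on S (\<lambda>G. inflow V (curry G) v)" for v and S :: "('v \<times> 'v \<Rightarrow> real) set"
    unfolding inflow_def curry_def
    by (intro continuous_on_sum continuous_on_subset[OF continuous_on_product_coordinates]) simp
  have "compact B"
    unfolding B_def compactin_euclidean_iff[symmetric] euclidean_product_topology[symmetric]
    by (subst compactin_PiE) (auto split: prod.split)
  moreover have "closed {G. inflow V (curry G) v \<in> A v}" for v
    using closed_vimage[OF assms(1) cont[of UNIV v]] by (simp add: vimage_def)
  then have "closed N"
    unfolding N_def Ball_def
    by (intro closed_Int closed_Collect_all closed_Collect_eq closed_Collect_imp open_Collect_const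
        continuous_on_minus continuous_on_product_coordinates)
  ultimately have "compact (B \<inter> N)"
    by (rule compact_Int_closed)
  moreover have "(\<lambda>_. 0) \<in> B \<inter> N"
    using assms(2) by (auto simp: B_def N_def cap_ge_0 inflow_def)
  moreover have "continuous_on (B \<inter> N) (\<lambda>G. \<Sum>v\<in>W. inflow V (curry G) v)"
    by (intro continuous_on_sum cont)
  ultimately obtain G where G: "G \<in> B \<inter> N"
    and max: "\<forall>G'\<in>B \<inter> N. (\<Sum>v\<in>W. inflow V (curry G') v) \<le> (\<Sum>v\<in>W. inflow V (curry G) v)"
    using continuous_attains_sup[of "B \<inter> N"] by blast
  have iff: "H \<in> B \<inter> N \<longleftrightarrow> netflow (curry H) \<and> (\<forall>v\<in>V. inflow V (curry H) v \<in> A v)" for H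
  proof -
    have "H \<in> B \<longleftrightarrow> (\<forall>u v. \<bar>curry H u v\<bar> \<le> cap u v)"
      by (auto simp: B_def PiE_iff abs_le_iff minus_le_iff)
    then show ?thesis
      unfolding N_def netflow_def skew_def by (simp only: Int_iff mem_Collect_eq curry_conv conj_ac)
  qed
  show thesis
  proof (rule that)
    show "netflow (curry G)" "\<And>v. v \<in> V \<Longrightarrow> inflow V (curry G) v \<in> A v"
      using G iff by auto
    show "(\<Sum>v\<in>W. inflow V g' v) \<le> (\<Sum>v\<in>W. inflow V (curry G) v)"
      if "netflow g'" "\<And>v. v \<in> V \<Longrightarrow> inflow V g' v \<in> A v" for g'
      using bspec[OF max, of "case_prod g'"] iff[of "case_prod g'"] that by simp
  qed
qed

section \<open>Residual reachability\<close>

text \<open>An arc whose reverse carries flow is residual too, because then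
  \<open>g u v < 0 \<le> cap u v\<close>; pushing along it undoes the reverse flow.\<close>

definition residual :: "('v \<Rightarrow> 'v \<Rightarrow> real) \<Rightarrow> ('v \<times> 'v) set" where
  "residual g = {(u, v). g u v < cap u v}"

lemma residual_edge: "netflow g \<Longrightarrow> (u, v) \<in> residual g \<Longrightarrow> {u, v} \<in> E"
  using netflow_nonedge[of g u v] by (auto simp: residual_def cap_def split: if_splits)

text \<open>
  The directions carried by residual arcs are closed under addition, so that an augmenting walk
  need not be shortened to a simple path.
\<close>

lemma residual_direction:
  assumes "netflow g" and "(a, b) \<in> (residual g)\<^sup>*"
  shows "\<exists>h. skew h \<and> (\<forall>u v. 0 < h u v \<longrightarrow> (u, v) \<in> residual g) \<and>
           (\<forall>v\<in>V. inflow V h v = of_bool (v = b) - of_bool (v = a))"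
  using assms(2)
proof induction
  case base
  show ?case by (intro exI[of _ "\<lambda>_ _. 0"]) (simp add: inflow_def skewI)
next
  case (step b b')
  then obtain h where h: "skew h" "\<And>u v. 0 < h u v \<Longrightarrow> (u, v) \<in> residual g"
    "\<And>v. v \<in> V \<Longrightarrow> inflow V h v = of_bool (v = b) - of_bool (v = a)" by blast
  have b: "b \<in> V" "b' \<in> V" "b \<noteq> b'"
    using residual_edge[OF assms(1) step.hyps(2)] edgeD by auto
  define k where "k = net (\<lambda>u v. of_bool (u = b \<and> v = b'))"
  show ?case
  proof (intro exI[of _ "\<lambda>u v. h u v + k u v"] conjI allI ballI impI)
    show "skew (\<lambda>u v. h u v + k u v)"
      unfolding k_def by (intro skew_add h(1) skew_net)
    \<comment> \<open>A positive sum has a positive summand, and \<open>k\<close>, one unit along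
      the new arc, is positive only on \<open>(b, b')\<close>.\<close>
    show "(u, v) \<in> residual g" if "0 < h u v + k u v" for u v
    proof (cases "0 < h u v")
      case False
      then have "0 < k u v" using that by linarith
      then have "u = b \<and> v = b'"
        by (cases "u = b \<and> v = b'"; cases "v = b \<and> u = b'") (simp_all add: k_def net_def not_less)
      then show ?thesis using step.hyps(2) by simp
    qed (rule h(2))
    have "inflow V k v = of_bool (v = b') - of_bool (v = b)" for v
      using b finite_V by (simp add: k_def inflow_net of_bool_conj)
    then show "inflow V (\<lambda>u v. h u v + k u v) v = of_bool (v = b') - of_bool (v = a)"
      if "v \<in> V" for v
      using h(3)[OF that] by (simp add: inflow_add)
  qed
qed

text \<open>Adding a small multiple of a residual direction \<open>h\<close> respects the
  capacities: where \<open>h\<close> is positive there is slack, elsewhere the flow does not grow.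
  The bound \<open>\<delta>\<close> lets a caller keep the delivered amount below a limit.\<close>

lemma augment:
  assumes "netflow g" and "(a, b) \<in> (residual g)\<^sup>*" and "0 < \<delta>"
  obtains g' \<epsilon> where "0 < \<epsilon>" and "\<epsilon> \<le> \<delta>" and "netflow g'"
    and "\<And>v. v \<in> V \<Longrightarrow> inflow V g' v = inflow V g v + \<epsilon> * (of_bool (v = b) - of_bool (v = a))"
proof -
  obtain h where h: "skew h" "\<And>u v. 0 < h u v \<Longrightarrow> (u, v) \<in> residual g"
    "\<And>v. v \<in> V \<Longrightarrow> inflow V h v = of_bool (v = b) - of_bool (v = a)"
    using residual_direction[OF assms(1,2)] by blast
  have ev: "\<forall>\<^sub>F \<epsilon> in at_right 0. g u v + \<epsilon> * h u v \<le> cap u v" for u v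
  proof (cases "0 < h u v")
    case True
    have "((\<lambda>\<epsilon>. g u v + \<epsilon> * h u v) \<longlongrightarrow> g u v + 0 * h u v) (at_right 0)"
      by (intro tendsto_intros)
    moreover have "g u v + 0 * h u v < cap u v"
      using h(2)[OF True] by (simp add: residual_def)
    ultimately have "\<forall>\<^sub>F \<epsilon> in at_right 0. g u v + \<epsilon> * h u v < cap u v"
      by (rule order_tendstoD)
    then show ?thesis by eventually_elim simp
  next
    case False
    then have "g u v + \<epsilon> * h u v \<le> cap u v" if "0 < \<epsilon>" for \<epsilon>
      using that netflow_le_cap[OF assms(1), of u v] mult_nonneg_nonpos[of \<epsilon> "h u v"] by linarith
    then show ?thesis
      by (intro eventually_mono[OF eventually_at_right_less[of "0::real"]])
  qed
  have "\<forall>\<^sub>F \<epsilon> in at_right 0. \<forall>(u, v)\<in>V \<times> V. g u v + \<epsilon> * h u v \<le> cap u v"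
    using finite_V ev by (intro eventually_ball_finite) (auto simp: finite_V)
  moreover have "\<forall>\<^sub>F \<epsilon> in at_right 0. \<epsilon> < \<delta>"
    using assms(3) by (rule order_tendstoD(2)[OF tendsto_ident_at])
  ultimately have "\<forall>\<^sub>F \<epsilon> in at_right 0. 0 < \<epsilon> \<and> \<epsilon> < \<delta> \<and> (\<forall>(u, v)\<in>V \<times> V. g u v + \<epsilon> * h u v \<le> cap u v)"
    using eventually_at_right_less[of "0::real"] by eventually_elim simp
  then obtain \<epsilon> where \<epsilon>: "0 < \<epsilon>" "\<epsilon> < \<delta>" "\<And>u v. u \<in> V \<Longrightarrow> v \<in> V \<Longrightarrow> g u v + \<epsilon> * h u v \<le> cap u v"
    using eventually_happens'[OF trivial_limit_at_right_real] by blast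
  \<comment> \<open>The common \<open>\<epsilon>\<close> serves only the finitely many pairs in
    \<open>V \<times> V\<close>. Outside them \<open>h\<close> vanishes, since residual arcs are
    edges.\<close>
  have h0: "h u v = 0" if "\<not> (u \<in> V \<and> v \<in> V)" for u v
  proof -
    have "\<not> 0 < h u v" "\<not> 0 < h v u"
      using that h(2) residual_edge[OF assms(1)] edgeD by meson+
    then show ?thesis using skewD[OF h(1), of u v] by linarith
  qed
  show thesis
  proof (rule that[of \<epsilon> "\<lambda>u v. g u v + \<epsilon> * h u v"])
    show "netflow (\<lambda>u v. g u v + \<epsilon> * h u v)"
    proof (rule netflowI)
      show "skew (\<lambda>u v. g u v + \<epsilon> * h u v)"
        by (intro skew_add skew_scale netflow_skew assms(1) h(1))
      show "g u v + \<epsilon> * h u v \<le> cap u v" for u v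
        using \<epsilon>(3)[of u v] h0[of u v] netflow_le_cap[OF assms(1), of u v] by fastforce
    qed
  qed (use \<epsilon> h(3) in \<open>auto simp: inflow_add inflow_scale\<close>)
qed

text \<open>Any arc from a reachable to an unreachable vertex is saturated by \<open>g\<close>,
  otherwise its head would be reachable. Hence no net flow carries more across this cut.\<close>

lemma residual_cut_maximal:
  fixes a :: 'v
  assumes "netflow g" and "netflow g'"
  defines "R \<equiv> {v \<in> V. (a, v) \<notin> (residual g)\<^sup>*}"
  shows "(\<Sum>v\<in>R. inflow V g' v) \<le> (\<Sum>v\<in>R. inflow V g v)"
proof -
  have "R \<subseteq> V" by (auto simp: R_def)
  have "g' u v \<le> g u v" if "u \<in> V - R" "v \<in> R" for u v
  proof -
    have "(u, v) \<notin> residual g"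
      using that by (auto simp: R_def dest: rtrancl_into_rtrancl)
    then show ?thesis
      using netflow_le_cap[OF assms(2), of u v] by (simp add: residual_def)
  qed
  then have "(\<Sum>v\<in>R. \<Sum>u\<in>V - R. g' u v) \<le> (\<Sum>v\<in>R. \<Sum>u\<in>V - R. g u v)"
    by (intro sum_mono)
  moreover have "(\<Sum>v\<in>R. inflow V k v) = (\<Sum>v\<in>R. \<Sum>u\<in>V - R. k u v)" if "netflow k" for k
    using finite_V \<open>R \<subseteq> V\<close> netflow_skew[OF that] by (rule sum_inflow_cut)
  ultimately show ?thesis
    using assms(1,2) by simp
qed

lemma sum_inflow_restrict:
  assumes "T \<subseteq> V" and "S \<subseteq> T" and "\<And>v. v \<in> T - S \<Longrightarrow> inflow V g v = 0"
  shows "(\<Sum>v\<in>T. inflow V g v) = (\<Sum>v\<in>S. inflow V g v)"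
  using assms finite_V by (intro sum.mono_neutral_right) (auto intro: finite_subset)

text \<open>The given flows act as competitors on a cut: \<open>gT\<close> when the cut separates
  both \<open>s\<close> and \<open>d\<close> from \<open>t\<close>, and \<open>gs\<close> or
  \<open>gd\<close> when it separates only one of them.\<close>

lemma two_sink_netflow:
  assumes std: "s \<in> V" "t \<in> V" "d \<in> V" "s \<noteq> t" "t \<noteq> d" "s \<noteq> d" and "0 \<le> r"
    and gT: "netflow gT" "\<And>v. v \<in> V - {s, t, d} \<Longrightarrow> inflow V gT v = 0"
      "2 * r \<le> inflow V gT s + inflow V gT d"
    and gs: "netflow gs" "\<And>v. v \<in> V - {s, t} \<Longrightarrow> inflow V gs v = 0" "r \<le> inflow V gs s"
    and gd: "netflow gd" "\<And>v. v \<in> V - {t, d} \<Longrightarrow> inflow V gd v = 0" "r \<le> inflow V gd d"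
  obtains g where "netflow g" and "\<And>v. v \<in> V - {s, t, d} \<Longrightarrow> inflow V g v = 0"
    and "inflow V g s = r" and "inflow V g d = r"
proof -
  \<comment> \<open>The source \<open>t\<close> is free, each sink may receive at most
    \<open>r\<close>, and all other vertices conserve flow. The zero flow is admissible because
    \<open>0 \<le> r\<close>.\<close>
  define A where "A v = (if v = t then UNIV else if v \<in> {s, d} then {0..r} else {0})" for v
  have "closed (A v)" "0 \<in> A v" for v
    using \<open>0 \<le> r\<close> by (simp_all add: A_def)
  then obtain g where g: "netflow g" and gA: "\<And>v. v \<in> V \<Longrightarrow> inflow V g v \<in> A v"
    and gmax: "\<And>g'. netflow g' \<Longrightarrow> (\<And>v. v \<in> V \<Longrightarrow> inflow V g' v \<in> A v) \<Longrightarrow>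
       (\<Sum>v\<in>{s, d}. inflow V g' v) \<le> (\<Sum>v\<in>{s, d}. inflow V g v)"
    by (rule max_netflow_exists[of A "{s, d}"]) blast
  define R where "R = {v \<in> V. (t, v) \<notin> (residual g)\<^sup>*}"
  have "R \<subseteq> V" "t \<notin> R" by (auto simp: R_def)
  have g0: "inflow V g v = 0" if "v \<in> V - {s, t, d}" for v
    using gA[of v] that by (simp add: A_def)
  have gsd: "0 \<le> inflow V g v" "inflow V g v \<le> r" if "v \<in> {s, d}" for v
    using gA[of v] that std by (auto simp: A_def split: if_splits)
  \<comment> \<open>By conservation the only vertices of \<open>R\<close> that contribute to the cut
    inequality are the sinks in it.\<close>
  have cut: "(\<Sum>v\<in>R \<inter> {s, d}. inflow V g' v) \<le> (\<Sum>v\<in>R \<inter> {s, d}. inflow V g v)"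
    if "netflow g'" "\<And>v. v \<in> V - {s, t, d} \<Longrightarrow> inflow V g' v = 0" for g'
  proof -
    have eq: "(\<Sum>v\<in>R. inflow V k v) = (\<Sum>v\<in>R \<inter> {s, d}. inflow V k v)"
      if "\<And>v. v \<in> V - {s, t, d} \<Longrightarrow> inflow V k v = 0" for k
      using that \<open>R \<subseteq> V\<close> \<open>t \<notin> R\<close> by (intro sum_inflow_restrict) auto
    show ?thesis
      using residual_cut_maximal[OF g that(1), of t] eq[of g, OF g0] eq[of g', OF that(2)]
      unfolding R_def by simp
  qed
  \<comment> \<open>If \<open>v\<close> were reachable, augmenting by at most the missing amount
    would keep its delivery within \<open>{0..r}\<close> and raise the total.\<close>
  have unsat: "v \<in> R" if v: "v \<in> {s, d}" "inflow V g v < r" for v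
  proof (rule ccontr)
    assume "v \<notin> R"
    then have "(t, v) \<in> (residual g)\<^sup>*"
      using v std by (auto simp: R_def)
    moreover have "0 < r - inflow V g v"
      using v by simp
    ultimately obtain g' \<epsilon> where \<epsilon>: "0 < \<epsilon>" "\<epsilon> \<le> r - inflow V g v" "netflow g'"
      "\<And>w. w \<in> V \<Longrightarrow> inflow V g' w = inflow V g w + \<epsilon> * (of_bool (w = v) - of_bool (w = t))"
      by (rule augment[OF g]) blast
    have "inflow V g' w \<in> A w" if "w \<in> V" for w
      using gA[OF that] \<epsilon>(1,2) \<epsilon>(4)[OF that] v std by (auto simp: A_def)
    from gmax[OF \<epsilon>(3) this] show False
      using \<epsilon>(1,4) v std by auto
  qed
  \<comment> \<open>If \<open>d\<close> is in \<open>R\<close>, comparison with \<open>gT\<close>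
    gives \<open>g\<close> a total of at least \<open>2 * r\<close>, although \<open>s\<close> gets
    less than \<open>r\<close> and \<open>d\<close> at most \<open>r\<close>. Otherwise comparison
    with \<open>gs\<close> gives \<open>s\<close> at least \<open>r\<close>.\<close>
  have "\<not> inflow V g s < r"
  proof
    assume "inflow V g s < r"
    then show False
      using unsat[of s] cut[OF gT(1,2)] cut[of gs] gs gT(3) gsd[of d] std
      by (cases "d \<in> R") auto
  qed
  moreover have "\<not> inflow V g d < r"
  proof
    assume "inflow V g d < r"
    then show False
      using unsat[of d] cut[OF gT(1,2)] cut[of gd] gd gT(3) gsd[of s] std
      by (cases "s \<in> R") auto
  qed
  ultimately show thesis
    using that[OF g g0] gsd[of s] gsd[of d] by force
qed

end

section \<open>Path flows\<close>

text \<open>The directed counterpart of \<open>path_edges\<close>: the excess of a path flow depends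
  on the direction of travel.\<close>

definition arcs :: "'v list \<Rightarrow> ('v \<times> 'v) set" where
  "arcs p = set (zip p (tl p))"

lemma arcs_simps [simp]:
  "arcs [] = {}" "arcs [a] = {}" "arcs (a # b # p) = insert (a, b) (arcs (b # p))"
  by (simp_all add: arcs_def)

lemma arcs_subset: "arcs p \<subseteq> set p \<times> set p"
  by (induction p rule: induct_list012) auto

lemma arcs_append_Cons: "arcs (a # q) \<subseteq> arcs (p @ a # q)"
proof (induction p)
  case (Cons b p)
  then show ?case by (cases p) auto
qed simp

lemma path_edges_eq: "path_edges p = (\<lambda>(u, v). {u, v}) ` arcs p"
  by (force simp: path_edges_def arcs_def set_zip nth_tl image_iff)

lemma path_edges_rev: "path_edges (rev p) = path_edges p"
proof -
  have "path_edges (rev p) \<subseteq> path_edges p" for p :: "'a list"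
  proof
    fix e assume "e \<in> path_edges (rev p)"
    then obtain i where i: "Suc i < length p" "e = {rev p ! i, rev p ! Suc i}"
      by (auto simp: path_edges_def)
    \<comment> \<open>\<open>rev p ! i\<close> is \<open>p ! Suc j\<close> and
      \<open>rev p ! Suc i\<close> is \<open>p ! j\<close>.\<close>
    define j where "j = length p - Suc (Suc i)"
    have "Suc j < length p" "e = {p ! j, p ! Suc j}"
      using i by (auto simp: j_def rev_nth insert_commute Suc_diff_Suc)
    then show "e \<in> path_edges p"
      by (auto simp: path_edges_def)
  qed
  from this[of p] this[of "rev p"] show ?thesis by simp
qed

text \<open>The first vertex does not recur, so no later arc can reverse the first one. Thus a path
  never loads the same edge in both directions.\<close>

lemma arcs_converse:
  assumes "distinct p" and "(u, v) \<in> arcs p"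
  shows "(v, u) \<notin> arcs p"
  using assms
proof (induction p rule: induct_list012)
  case (3 a b p)
  then show ?case using arcs_subset[of "b # p"] by auto
qed simp_all

text \<open>Telescoping: the first arc moves a unit from \<open>a\<close> to \<open>b\<close>, and
  the remaining arcs carry it on to the end. Distinctness keeps the first arc out of the rest, so
  the indicators add up.\<close>

lemma arcs_imbalance:
  assumes "finite V" and "distinct p" and "p \<noteq> []" and "set p \<subseteq> V"
  shows "inflow V (net (\<lambda>u v. of_bool ((u, v) \<in> arcs p))) v = of_bool (v = last p) - of_bool (v = hd p)"
  using assms(2-)
proof (induction p rule: induct_list012)
  case (2 a)
  show ?case by (simp add: inflow_net)
next
  case (3 a b p)
  have "(a, b) \<notin> arcs (b # p)"
    using "3.prems" arcs_subset[of "b # p"] by auto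
  then have "of_bool ((u, v) \<in> arcs (a # b # p)) =
      of_bool (u = a) * of_bool (v = b) + (of_bool ((u, v) \<in> arcs (b # p)) :: real)" for u v
    by auto
  then have "inflow V (net (\<lambda>u v. of_bool ((u, v) \<in> arcs (a # b # p)))) v =
      inflow V (net (\<lambda>u v. of_bool (u = a) * of_bool (v = b))) v +
      inflow V (net (\<lambda>u v. of_bool ((u, v) \<in> arcs (b # p)))) v"
    by (simp add: inflow_net sum.distrib)
  moreover have "inflow V (net (\<lambda>u v. of_bool (u = a) * of_bool (v = b))) v =
      of_bool (v = b) - of_bool (v = a)"
    using "3.prems" \<open>finite V\<close> by (simp add: inflow_net)
  ultimately show ?case using 3 by simp
qed simp

lemma finite_paths:
  assumes "finite V"
  shows "finite (paths V E a b)"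
proof (rule finite_subset)
  show "paths V E a b \<subseteq> {p. set p \<subseteq> V \<and> length p \<le> card V}"
    using assms by (auto simp: paths_def distinct_card[symmetric] intro: card_mono)
qed (rule finite_lists_length_le[OF assms])

lemma rev_paths: "rev ` paths V E a b = paths V E b a"
proof -
  have "rev p \<in> paths V E b a" if "p \<in> paths V E a b" for p a b
    using that by (auto simp: paths_def hd_rev last_rev path_edges_rev)
  then show ?thesis
    by (force simp: image_iff intro: rev_rev_ident[symmetric])
qed

definition path_flow :: "'v list set \<Rightarrow> ('v list \<Rightarrow> real) \<Rightarrow> 'v \<Rightarrow> 'v \<Rightarrow> real" where
  "path_flow P x u v = (\<Sum>p\<in>P. x p * of_bool ((u, v) \<in> arcs p))"

lemma path_flow_nonneg: "(\<And>p. p \<in> P \<Longrightarrow> 0 \<le> x p) \<Longrightarrow> 0 \<le> path_flow P x u v"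
  by (auto simp: path_flow_def intro!: sum_nonneg)

lemma path_flow_add: "path_flow P (\<lambda>p. x p + y p) u v = path_flow P x u v + path_flow P y u v"
  by (simp add: path_flow_def sum.distrib distrib_right)

text \<open>By linearity each path contributes its weight times its imbalance, which sits at the two
  ends shared by all paths.\<close>

lemma inflow_path_flow:
  assumes "finite V" and "a \<noteq> b"
  shows "inflow V (net (path_flow (paths V E a b) x)) v =
    (\<Sum>p\<in>paths V E a b. x p) * (of_bool (v = b) - of_bool (v = a))"
proof -
  have "inflow V (net (path_flow (paths V E a b) x)) v =
    (\<Sum>p\<in>paths V E a b. x p * inflow V (net (\<lambda>u v. of_bool ((u, v) \<in> arcs p))) v)"
    unfolding inflow_def net_def path_flow_def
    by (subst sum_distrib_left, subst sum.swap) (simp add: sum_subtractf right_diff_distrib)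
  also have "\<dots> = (\<Sum>p\<in>paths V E a b. x p * (of_bool (v = b) - of_bool (v = a)))"
    using arcs_imbalance[OF assms(1)] by (intro sum.cong) (auto simp: paths_def)
  finally show ?thesis by (simp add: sum_distrib_right)
qed

text \<open>A path through an edge traverses it in at least one direction. This turns bounds on arc
  flows into bounds on path weights.\<close>

lemma path_flow_edge_le:
  assumes "finite P" and "\<And>p. p \<in> P \<Longrightarrow> 0 \<le> x p"
  shows "(\<Sum>p\<in>{p \<in> P. {u, v} \<in> path_edges p}. x p) \<le> path_flow P x u v + path_flow P x v u"
proof -
  have "(\<Sum>p\<in>{p \<in> P. {u, v} \<in> path_edges p}. x p) = (\<Sum>p\<in>P. x p * of_bool ({u, v} \<in> path_edges p))"
    using assms(1) by (simp add: sum.inter_filter of_bool_def if_distrib cong: if_cong)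
  also have "\<dots> \<le> (\<Sum>p\<in>P. x p * (of_bool ((u, v) \<in> arcs p) + of_bool ((v, u) \<in> arcs p)))"
    by (intro sum_mono mult_left_mono assms(2))
      (auto simp: path_edges_eq doubleton_eq_iff)
  finally show ?thesis by (simp add: path_flow_def distrib_left sum.distrib)
qed

text \<open>The converse comparison: a distinct path traverses an edge in at most one
  direction.\<close>

lemma path_flow_le_edge:
  assumes "finite P" and "\<And>p. p \<in> P \<Longrightarrow> 0 \<le> x p" and "\<And>p. p \<in> P \<Longrightarrow> distinct p"
  shows "path_flow P x u v + path_flow P x v u \<le> (\<Sum>p\<in>{p \<in> P. {u, v} \<in> path_edges p}. x p)"
proof -
  have "path_flow P x u v + path_flow P x v u =
      (\<Sum>p\<in>P. x p * (of_bool ((u, v) \<in> arcs p) + of_bool ((v, u) \<in> arcs p)))"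
    by (simp add: path_flow_def distrib_left sum.distrib)
  also have "\<dots> \<le> (\<Sum>p\<in>P. x p * of_bool ({u, v} \<in> path_edges p))"
  proof (intro sum_mono mult_left_mono assms(2))
    fix p assume "p \<in> P"
    then show "of_bool ((u, v) \<in> arcs p) + of_bool ((v, u) \<in> arcs p)
        \<le> (of_bool ({u, v} \<in> path_edges p) :: real)"
      using arcs_converse[OF assms(3), of p u v] by (force simp: path_edges_eq)
  qed
  also have "\<dots> = (\<Sum>p\<in>{p \<in> P. {u, v} \<in> path_edges p}. x p)"
    using assms(1) by (simp add: sum.inter_filter of_bool_def if_distrib cong: if_cong)
  finally show ?thesis .
qed

lemma rtrancl_distinct_path:
  assumes "(a, b) \<in> R\<^sup>*"
  obtains p where "p \<noteq> []" and "hd p = a" and "last p = b" and "distinct p" and "arcs p \<subseteq> R"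
proof -
  have "\<exists>p. p \<noteq> [] \<and> hd p = a \<and> last p = b \<and> distinct p \<and> arcs p \<subseteq> R"
    using assms
  proof (induction rule: converse_rtrancl_induct)
    case base
    show ?case by (intro exI[of _ "[b]"]) simp
  next
    case (step a a')
    then obtain p where p: "p \<noteq> []" "hd p = a'" "last p = b" "distinct p" "arcs p \<subseteq> R" by blast
    show ?case
    proof (cases "a \<in> set p")
      \<comment> \<open>The new start already lies on the path, so keeping only the part from there
        on cuts off the loop.\<close>
      case True
      then obtain q r where "p = q @ a # r" by (meson split_list)
      then show ?thesis
        using p arcs_append_Cons[of a r q] by (intro exI[of _ "a # r"]) auto
    next
      case False
      obtain q where "p = a' # q" using p by (cases p) auto
      then show ?thesis
        using p False step.hyps(1) by (intro exI[of _ "a # p"]) auto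
    qed
  qed
  with that show thesis by blast
qed

section \<open>Decomposition of arc flows into paths\<close>

context capacitated_graph
begin

lemma path_flow_nonedge:
  assumes "{u, v} \<notin> E"
  shows "path_flow (paths V E a b) x u v = 0"
proof -
  have "(u, v) \<notin> arcs p" if "p \<in> paths V E a b" for p
    using that assms by (force simp: paths_def path_edges_eq)
  then show ?thesis by (simp add: path_flow_def)
qed

text \<open>No flow enters the set \<open>R\<close> of vertices that reach \<open>b\<close> along
  positive arcs, so its total excess is at most zero. If \<open>a\<close> lay outside, all excesses
  in \<open>R\<close> would be nonnegative and that of \<open>b\<close> positive.\<close>

lemma positive_path_exists:
  assumes f: "\<And>u v. 0 \<le> f u v" "\<And>u v. {u, v} \<notin> E \<Longrightarrow> f u v = 0"
    and ex: "\<And>v. v \<in> V - {a} \<Longrightarrow> 0 \<le> inflow V (net f) v"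
    and b: "b \<in> V" "b \<noteq> a" "0 < inflow V (net f) b"
  obtains p where "p \<in> paths V E a b" and "\<And>u v. (u, v) \<in> arcs p \<Longrightarrow> 0 < f u v"
proof -
  define R where "R = {v \<in> V. (v, b) \<in> {(u, v). 0 < f u v}\<^sup>*}"
  have "R \<subseteq> V" by (auto simp: R_def)
  have fpos: "{u, v} \<in> E" if "0 < f u v" for u v
    using f(2)[of u v] that by (cases "{u, v} \<in> E") auto
  have "a \<in> R"
  proof (rule ccontr)
    assume "a \<notin> R"
    have "f u v = 0" if "u \<in> V - R" "v \<in> R" for u v
      using that f(1)[of u v] by (auto simp: R_def less_le intro: converse_rtrancl_into_rtrancl)
    then have "(\<Sum>v\<in>R. \<Sum>u\<in>V - R. net f u v) \<le> 0"
      using f(1) by (intro sum_nonpos) (simp add: net_def)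
    then have "(\<Sum>v\<in>R. inflow V (net f) v) \<le> 0"
      using sum_inflow_cut[OF finite_V \<open>R \<subseteq> V\<close> skew_net] by simp
    moreover have "0 < (\<Sum>v\<in>R. inflow V (net f) v)"
    proof (rule sum_pos2)
      show "finite R" using finite_V by (simp add: R_def)
      show "b \<in> R" using b by (simp add: R_def)
      show "0 \<le> inflow V (net f) v" if "v \<in> R" for v
        using that \<open>a \<notin> R\<close> \<open>R \<subseteq> V\<close> by (intro ex) auto
    qed (rule b)
    ultimately show False by simp
  qed
  then have "a \<in> V" "(a, b) \<in> {(u, v). 0 < f u v}\<^sup>*" by (auto simp: R_def)
  from this(2) obtain p where p: "p \<noteq> []" "hd p = a" "last p = b" "distinct p"
    "arcs p \<subseteq> {(u, v). 0 < f u v}" by (rule rtrancl_distinct_path)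
  have edges: "path_edges p \<subseteq> E"
    using p(5) fpos by (auto simp: path_edges_eq)
  have "set p \<subseteq> V"
  proof
    fix v assume "v \<in> set p"
    then obtain i where i: "i < length p" "v = p ! i" by (auto simp: in_set_conv_nth)
    show "v \<in> V"
    proof (cases i)
      case 0
      then show ?thesis using i p \<open>a \<in> V\<close> by (simp add: hd_conv_nth)
    next
      case (Suc j)
      then have "{p ! j, p ! i} \<in> path_edges p" using i by (auto simp: path_edges_def)
      then show ?thesis using edges edgeD i(2) by blast
    qed
  qed
  with p edges show thesis
    by (intro that[of p]) (auto simp: paths_def)
qed

text \<open>Induction on the number of positive arcs: a path peeled off with its bottleneck amount
  either meets the demand or empties an arc. Since excess is allowed at vertices other than
  \<open>b\<close>, flow meant for another sink can stay behind in \<open>f\<close>.\<close>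

lemma path_decomposition:
  assumes "\<And>u v. 0 \<le> f u v" and "\<And>u v. {u, v} \<notin> E \<Longrightarrow> f u v = 0"
    and "\<And>v. v \<in> V - {a} \<Longrightarrow> 0 \<le> inflow V (net f) v"
    and "b \<in> V" and "b \<noteq> a" and "0 \<le> r" and "r \<le> inflow V (net f) b"
  shows "\<exists>x. (\<forall>p. 0 \<le> x p) \<and> (\<Sum>p\<in>paths V E a b. x p) = r \<and>
    (\<forall>u v. path_flow (paths V E a b) x u v \<le> f u v)"
  using assms
proof (induction "card {(u, v) \<in> V \<times> V. 0 < f u v}" arbitrary: f r rule: less_induct)
  case less
  let ?P = "paths V E a b"
  have fin: "finite ?P" by (rule finite_paths[OF finite_V])
  show ?case
  proof (cases "r = 0")
    case True
    then show ?thesis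
      using less.prems(1) by (intro exI[of _ "\<lambda>_. 0"]) (simp add: path_flow_def)
  next
    case False
    then have "0 < inflow V (net f) b" using less.prems by linarith
    then obtain p where p: "p \<in> ?P" "\<And>u v. (u, v) \<in> arcs p \<Longrightarrow> 0 < f u v"
      using positive_path_exists[of f a b] less.prems by metis
    \<comment> \<open>The bottleneck of the path, capped by the demand \<open>r\<close> so that the
      remaining demand is not negative.\<close>
    define \<delta> where "\<delta> = Min (insert r ((\<lambda>(u, v). f u v) ` arcs p))"
    have finA: "finite (arcs p)" by (simp add: arcs_def)
    have \<delta>: "\<delta> \<le> r" "\<And>u v. (u, v) \<in> arcs p \<Longrightarrow> \<delta> \<le> f u v"
      using finA by (auto simp: \<delta>_def intro!: Min_le)
    have "0 < \<delta>"
      using finA p(2) False less.prems(6) by (auto simp: \<delta>_def)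
    define y where "y q = \<delta> * of_bool (q = p)" for q
    define f' where "f' u v = f u v - path_flow ?P y u v" for u v
    have y: "path_flow ?P y u v = \<delta> * of_bool ((u, v) \<in> arcs p)" for u v
      using fin p(1) by (simp add: path_flow_def y_def sum_distrib_left[symmetric] mult.assoc)
    have sum_y: "sum y ?P = \<delta>"
      using fin p(1) by (simp add: y_def sum_distrib_left[symmetric])
    have f'_le: "0 \<le> f' u v" "f' u v \<le> f u v" for u v
      using \<delta>(2)[of u v] less.prems(1)[of u v] \<open>0 < \<delta>\<close> by (auto simp: f'_def y)
    have "\<exists>z. (\<forall>p. 0 \<le> z p) \<and> sum z ?P = r - \<delta> \<and> (\<forall>u v. path_flow ?P z u v \<le> f' u v)"
    proof (cases "\<delta> = r")
      case True
      then show ?thesis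
        using f'_le by (intro exI[of _ "\<lambda>_. 0"]) (simp add: path_flow_def)
    next
      case False
      have "\<delta> \<in> insert r ((\<lambda>(u, v). f u v) ` arcs p)"
        unfolding \<delta>_def using finA by (intro Min_in) auto
      with False obtain u0 v0 where uv: "(u0, v0) \<in> arcs p" "f u0 v0 = \<delta>" by auto
      have uvV: "u0 \<in> V" "v0 \<in> V"
        using uv(1) arcs_subset[of p] p(1) by (auto simp: paths_def)
      \<comment> \<open>The bottleneck arc \<open>(u0, v0)\<close> is positive in \<open>f\<close>
        and empty in \<open>f'\<close>, so the induction measure drops.\<close>
      have "{(u, v) \<in> V \<times> V. 0 < f' u v} \<subset> {(u, v) \<in> V \<times> V. 0 < f u v}"
      proof
        show "{(u, v) \<in> V \<times> V. 0 < f' u v} \<subseteq> {(u, v) \<in> V \<times> V. 0 < f u v}"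
          using f'_le(2) by (auto intro: less_le_trans)
        have "(u0, v0) \<notin> {(u, v) \<in> V \<times> V. 0 < f' u v}"
          using uv by (simp add: f'_def y)
        moreover have "(u0, v0) \<in> {(u, v) \<in> V \<times> V. 0 < f u v}"
          using uvV p(2)[OF uv(1)] by simp
        ultimately show "{(u, v) \<in> V \<times> V. 0 < f' u v} \<noteq> {(u, v) \<in> V \<times> V. 0 < f u v}"
          by metis
      qed
      then have "card {(u, v) \<in> V \<times> V. 0 < f' u v} < card {(u, v) \<in> V \<times> V. 0 < f u v}"
        by (intro psubset_card_mono) (auto intro: finite_subset[of _ "V \<times> V"] simp: finite_V)
      moreover have inflow': "inflow V (net f') v =
          inflow V (net f) v - \<delta> * (of_bool (v = b) - of_bool (v = a))" for v
        using inflow_path_flow[OF finite_V, of a b E y v] less.prems(5) sum_y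
        by (simp add: f'_def[abs_def] net_diff inflow_diff)
      \<comment> \<open>Away from \<open>a\<close> only \<open>b\<close> loses excess, and it loses
        \<open>\<delta> \<le> r\<close>, which it has.\<close>
      moreover have "0 \<le> inflow V (net f') v" if "v \<in> V - {a}" for v
        using less.prems(3)[OF that] less.prems(7) that \<delta>(1) unfolding inflow' by auto
      moreover have "f' u v = 0" if "{u, v} \<notin> E" for u v
        using f'_le[of u v] less.prems(2)[OF that] by simp
      ultimately show ?thesis
        using f'_le(1) less.prems(4,5,7) \<delta>(1) by (intro less.hyps) auto
    qed
    then obtain z where z: "\<And>p. 0 \<le> z p" "sum z ?P = r - \<delta>" "\<And>u v. path_flow ?P z u v \<le> f' u v"
      by blast
    have "path_flow ?P (\<lambda>p. z p + y p) u v \<le> f u v" for u v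
      using z(3)[of u v] by (simp add: path_flow_add f'_def)
    moreover have "0 \<le> z q + y q" for q
      using z(1)[of q] \<open>0 < \<delta>\<close> by (simp add: y_def)
    moreover have "(\<Sum>p\<in>?P. z p + y p) = r"
      using z(2) sum_y by (simp add: sum.distrib)
    ultimately show ?thesis
      by (intro exI[of _ "\<lambda>p. z p + y p"]) simp
  qed
qed

end

section \<open>Maximum flows as maxima over net flows\<close>

lemma flow_value_eq: "flow_value V a f = - inflow V (net f) a"
  by (simp add: flow_value_def inflow_net)

text \<open>\<open>GREATEST\<close> yields a maximum only where one is attained, hence the witness
  \<open>f\<close> beside the upper bound.\<close>

lemma max_flow_eqI:
  assumes "is_flow V E c a b f" and "flow_value V a f = r"
    and "\<And>f. is_flow V E c a b f \<Longrightarrow> flow_value V a f \<le> r"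
  shows "max_flow V E c a b = r"
  unfolding max_flow_def using assms by (intro Greatest_equality) auto

text \<open>The way back from net flows to flows: of the two directions of an edge only the one with
  positive net amount is used.\<close>

lemma net_positive_part:
  assumes "skew g"
  shows "net (\<lambda>u v. max 0 (g u v)) = g"
proof (intro ext)
  show "net (\<lambda>u v. max 0 (g u v)) u v = g u v" for u v
    using skewD[OF assms, of u v] by (simp add: net_def max_def)
qed

context capacitated_graph
begin

lemma netflow_net:
  assumes "\<And>u v. 0 \<le> f u v" and "\<And>u v. {u, v} \<notin> E \<Longrightarrow> f u v = 0"
    and "\<And>u v. {u, v} \<in> E \<Longrightarrow> f u v + f v u \<le> c {u, v}"
  shows "netflow (net f)"
proof (rule netflowI[OF skew_net])
  show "net f u v \<le> cap u v" for u v
    using assms(1)[of v u] assms(2)[of u v] assms(3)[of u v] by (auto simp: net_def cap_def)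
qed

lemma netflow_positive_part_cap:
  assumes "netflow g" and "{u, v} \<in> E"
  shows "max 0 (g u v) + max 0 (g v u) \<le> c {u, v}"
  using assms(2) skewD[OF netflow_skew[OF assms(1)], of u v] netflow_le_cap[OF assms(1), of u v]
    netflow_le_cap[OF assms(1), of v u] cap_nonneg[OF assms(2)]
  by (simp add: cap_def insert_commute max_def)

lemma sum_inflow_terminals:
  assumes "skew g" and "S \<subseteq> V" and "\<And>v. v \<in> V - S \<Longrightarrow> inflow V g v = 0"
  shows "(\<Sum>v\<in>S. inflow V g v) = 0"
  using sum_inflow_restrict[OF order_refl assms(2,3)] sum_inflow_cut[OF finite_V order_refl assms(1)]
  by simp

text \<open>Taking \<open>net\<close> and taking positive parts translate between flows and net
  flows without changing excesses, so both problems have the same maximum, and compactness shows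
  that it is attained.\<close>

lemma max_flow_netflow:
  assumes ab: "a \<in> V" "b \<in> V" "a \<noteq> b"
  obtains g where "netflow g" and "\<And>v. v \<in> V - {a, b} \<Longrightarrow> inflow V g v = 0"
    and "inflow V g b = max_flow V E (\<lambda>e. ereal (c e)) a b"
    and "\<And>g'. netflow g' \<Longrightarrow> (\<And>v. v \<in> V - {a, b} \<Longrightarrow> inflow V g' v = 0) \<Longrightarrow>
           inflow V g' b \<le> max_flow V E (\<lambda>e. ereal (c e)) a b"
proof -
  define A where "A v = (if v \<in> {a, b} then UNIV else {0 :: real})" for v
  have "closed (A v)" "0 \<in> A v" for v
    by (simp_all add: A_def)
  then obtain g where g: "netflow g" and gA: "\<And>v. v \<in> V \<Longrightarrow> inflow V g v \<in> A v"
    and gmax: "\<And>g'. netflow g' \<Longrightarrow> (\<And>v. v \<in> V \<Longrightarrow> inflow V g' v \<in> A v) \<Longrightarrow>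
       (\<Sum>v\<in>{b}. inflow V g' v) \<le> (\<Sum>v\<in>{b}. inflow V g v)"
    by (rule max_netflow_exists[of A "{b}"]) blast
  have g0: "inflow V g v = 0" if "v \<in> V - {a, b}" for v
    using gA[of v] that by (simp add: A_def)
  have gmax': "inflow V g' b \<le> inflow V g b"
    if "netflow g'" "\<And>v. v \<in> V - {a, b} \<Longrightarrow> inflow V g' v = 0" for g'
    using gmax[OF that(1)] that(2) by (simp add: A_def)
  \<comment> \<open>\<open>flow_value\<close> is measured at the source \<open>a\<close>, the
    maximum above at the sink \<open>b\<close>; total excess zero links the two.\<close>
  have bal: "- inflow V k a = inflow V k b"
    if "skew k" "\<And>v. v \<in> V - {a, b} \<Longrightarrow> inflow V k v = 0" for k
    using sum_inflow_terminals[of k "{a, b}"] that ab by simp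
  have flow: "is_flow V E (\<lambda>e. ereal (c e)) a b (\<lambda>u v. max 0 (g u v))"
    unfolding is_flow_def
  proof (intro conjI allI impI ballI)
    show "max 0 (g u v) = 0" if "{u, v} \<notin> E" for u v
      using netflow_nonedge[OF g that] by simp
    show "(\<Sum>u\<in>V. max 0 (g u v)) = (\<Sum>u\<in>V. max 0 (g v u))" if "v \<in> V - {a, b}" for v
      using g0[OF that] inflow_net[of V "\<lambda>u v. max 0 (g u v)" v]
      by (simp add: net_positive_part netflow_skew g)
  qed (use netflow_positive_part_cap[OF g] in auto)
  have "max_flow V E (\<lambda>e. ereal (c e)) a b = inflow V g b"
  proof (rule max_flow_eqI[OF flow])
    show "flow_value V a (\<lambda>u v. max 0 (g u v)) = inflow V g b"
      using bal[OF netflow_skew[OF g] g0]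
      by (simp add: flow_value_eq net_positive_part netflow_skew g)
    show "flow_value V a f \<le> inflow V g b" if f: "is_flow V E (\<lambda>e. ereal (c e)) a b f" for f
    proof -
      have f0: "inflow V (net f) v = 0" if "v \<in> V - {a, b}" for v
        using f that by (simp add: is_flow_def inflow_net)
      have "netflow (net f)"
        using f by (intro netflow_net) (auto simp: is_flow_def)
      from gmax'[OF this f0] bal[OF skew_net f0] show ?thesis
        by (simp add: flow_value_eq)
    qed
  qed
  then show thesis
    using that[OF g g0] gmax' by simp
qed

end

section \<open>The graph extended by a common sink\<close>

lemma Some_image_doubleton: "{Some u, Some v} = Some ` e \<longleftrightarrow> e = {u, v}"
  by (metis image_empty image_insert inj_Some inj_image_eq_iff)

lemma ext_edge_Some: "{Some u, Some v} \<in> ext_edges E s d \<longleftrightarrow> {u, v} \<in> E"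
  by (auto simp: ext_edges_def image_iff Some_image_doubleton doubleton_eq_iff)

lemma ext_edge_None:
  "{None, Some v} \<in> ext_edges E s d \<longleftrightarrow> v \<in> {s, d}"
  "{Some v, None} \<in> ext_edges E s d \<longleftrightarrow> v \<in> {s, d}"
  by (auto simp: ext_edges_def doubleton_eq_iff)

lemma ext_cap_Some: "ext_cap c {Some u, Some v} = ereal (c {u, v})"
proof -
  have "Some -` {Some u, Some v} = {u, v}" by auto
  then show ?thesis by (simp add: ext_cap_def)
qed

lemma ext_cap_None: "None \<in> e \<Longrightarrow> ext_cap c e = \<infinity>"
  by (simp add: ext_cap_def)

lemma sum_ext_verts:
  assumes "finite V"
  shows "(\<Sum>x\<in>ext_verts V. h x) = h None + (\<Sum>v\<in>V. h (Some v))"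
  using assms by (simp add: ext_verts_def sum.reindex)

context capacitated_graph
begin

text \<open>The infinite edges at the new node absorb any excess at \<open>s\<close> and
  \<open>d\<close>. What remains inside the graph is a net flow conserved off
  \<open>{s, t, d}\<close>.\<close>

lemma max_flow_ext_netflow:
  assumes std: "s \<in> V" "t \<in> V" "d \<in> V" "s \<noteq> t" "t \<noteq> d" "s \<noteq> d"
  obtains g where "netflow g" and "\<And>v. v \<in> V - {s, t, d} \<Longrightarrow> inflow V g v = 0"
    and "inflow V g s + inflow V g d =
      max_flow (ext_verts V) (ext_edges E s d) (ext_cap c) (Some t) None"
    and "\<And>g'. netflow g' \<Longrightarrow> (\<And>v. v \<in> V - {s, t, d} \<Longrightarrow> inflow V g' v = 0) \<Longrightarrow>
      inflow V g' s + inflow V g' d \<le>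
      max_flow (ext_verts V) (ext_edges E s d) (ext_cap c) (Some t) None"
proof -
  let ?flow = "is_flow (ext_verts V) (ext_edges E s d) (ext_cap c) (Some t) None"
  define A where "A v = (if v \<in> {s, t, d} then UNIV else {0 :: real})" for v
  have "closed (A v)" "0 \<in> A v" for v
    by (simp_all add: A_def)
  then obtain g where g: "netflow g" and gA: "\<And>v. v \<in> V \<Longrightarrow> inflow V g v \<in> A v"
    and gmax: "\<And>g'. netflow g' \<Longrightarrow> (\<And>v. v \<in> V \<Longrightarrow> inflow V g' v \<in> A v) \<Longrightarrow>
       (\<Sum>v\<in>{s, d}. inflow V g' v) \<le> (\<Sum>v\<in>{s, d}. inflow V g v)"
    by (rule max_netflow_exists[of A "{s, d}"]) blast
  have g0: "inflow V g v = 0" if "v \<in> V - {s, t, d}" for v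
    using gA[of v] that by (simp add: A_def)
  have gmax': "inflow V g' s + inflow V g' d \<le> inflow V g s + inflow V g d"
    if "netflow g'" "\<And>v. v \<in> V - {s, t, d} \<Longrightarrow> inflow V g' v = 0" for g'
    using gmax[OF that(1)] that(2) std by (simp add: A_def)
  have bal: "- inflow V k t = inflow V k s + inflow V k d"
    if "skew k" "\<And>v. v \<in> V - {s, t, d} \<Longrightarrow> inflow V k v = 0" for k
    using sum_inflow_terminals[of k "{s, t, d}"] that std by simp
  \<comment> \<open>Positive excess at \<open>s\<close> or \<open>d\<close> is passed on to the new
    node. Negative excess, which the maximiser may have at one of them, is supplied from there by
    \<open>fromT\<close>.\<close>
  define toT where "toT v = (if v \<in> {s, d} then max 0 (inflow V g v) else 0)" for v
  define fromT where "fromT v = (if v \<in> {s, d} then max 0 (- inflow V g v) else 0)" for v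
  define F where "F x y = (case x of
      None \<Rightarrow> (case y of None \<Rightarrow> 0 | Some v \<Rightarrow> fromT v)
    | Some u \<Rightarrow> (case y of None \<Rightarrow> toT u | Some v \<Rightarrow> max 0 (g u v)))" for x y
  have F_simps [simp]: "F None None = 0" "F None (Some v) = fromT v" "F (Some u) None = toT u"
    "F (Some u) (Some v) = max 0 (g u v)" for u v
    by (simp_all add: F_def)
  have F_inflow: "(\<Sum>x\<in>ext_verts V. F x (Some v)) - (\<Sum>x\<in>ext_verts V. F (Some v) x) =
      inflow V g v + fromT v - toT v" for v
    using inflow_net[of V "\<lambda>u v. max 0 (g u v)" v]
    by (simp add: sum_ext_verts finite_V net_positive_part netflow_skew g)
  have flow: "?flow F"
    unfolding is_flow_def
  proof (intro conjI allI impI ballI)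
    show "0 \<le> F x y" for x y
      by (cases x; cases y) (simp_all add: toT_def fromT_def)
    show "F x y = 0" if "{x, y} \<notin> ext_edges E s d" for x y
      using that netflow_nonedge[OF g]
      by (cases x; cases y) (simp_all add: toT_def fromT_def ext_edge_Some ext_edge_None)
    show "ereal (F x y + F y x) \<le> ext_cap c {x, y}" if "{x, y} \<in> ext_edges E s d" for x y
      using that netflow_positive_part_cap[OF g]
      by (cases x; cases y)
        (simp_all add: ext_cap_None ext_cap_Some ext_edge_Some del: ereal_max plus_ereal.simps)
    show "(\<Sum>x\<in>ext_verts V. F x w) = (\<Sum>x\<in>ext_verts V. F w x)"
      if w: "w \<in> ext_verts V - {Some t, None}" for w
    proof -
      obtain v where v: "w = Some v" "v \<in> V" "v \<noteq> t" using w by (auto simp: ext_verts_def)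
      then have "inflow V g v + fromT v - toT v = 0"
        using g0[of v] by (simp add: toT_def fromT_def max_def)
      then show ?thesis using F_inflow[of v] v(1) by simp
    qed
  qed
  have "max_flow (ext_verts V) (ext_edges E s d) (ext_cap c) (Some t) None =
      inflow V g s + inflow V g d"
  proof (rule max_flow_eqI[OF flow])
    show "flow_value (ext_verts V) (Some t) F = inflow V g s + inflow V g d"
      using F_inflow[of t] bal[OF netflow_skew[OF g] g0] std
      by (simp add: flow_value_def toT_def fromT_def)
    show "flow_value (ext_verts V) (Some t) f \<le> inflow V g s + inflow V g d" if f: "?flow f" for f
    proof -
      define h where "h u v = f (Some u) (Some v)" for u v
      have None_0: "f None (Some v) = 0" "f (Some v) None = 0" if "v \<notin> {s, d}" for v
        using f that ext_edge_None[of v E s d] unfolding is_flow_def by blast+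
      \<comment> \<open>Away from \<open>s\<close> and \<open>d\<close> no flow touches the new
        node, so excesses agree in both graphs; at \<open>t\<close> this recovers the flow
        value.\<close>
      have inflow_h: "inflow V (net h) v =
          (\<Sum>x\<in>ext_verts V. f x (Some v)) - (\<Sum>x\<in>ext_verts V. f (Some v) x)" if "v \<notin> {s, d}" for v
        using None_0[OF that] by (simp add: inflow_net h_def sum_ext_verts finite_V)
      have h0: "inflow V (net h) v = 0" if "v \<in> V - {s, t, d}" for v
      proof -
        have "Some v \<in> ext_verts V - {Some t, None}"
          using that by (simp add: ext_verts_def)
        then have "(\<Sum>x\<in>ext_verts V. f x (Some v)) = (\<Sum>x\<in>ext_verts V. f (Some v) x)"
          using f unfolding is_flow_def by blast
        then show ?thesis using inflow_h[of v] that by simp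
      qed
      have "netflow (net h)"
      proof (rule netflow_net)
        show "0 \<le> h u v" for u v
          using f by (simp add: is_flow_def h_def)
        show "h u v = 0" if "{u, v} \<notin> E" for u v
          using f that by (simp add: is_flow_def h_def ext_edge_Some)
        show "h u v + h v u \<le> c {u, v}" if "{u, v} \<in> E" for u v
        proof -
          have "ereal (f (Some u) (Some v) + f (Some v) (Some u)) \<le> ext_cap c {Some u, Some v}"
            using f that ext_edge_Some[of u v E s d] unfolding is_flow_def by blast
          then show ?thesis by (simp add: ext_cap_Some h_def)
        qed
      qed
      from gmax'[OF this h0] bal[OF skew_net h0] inflow_h[of t] std show ?thesis
        by (simp add: flow_value_def)
    qed
  qed
  then show thesis
    using that[OF g g0] gmax' by simp
qed

section \<open>Flows with a must-stop node\<close>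

lemma must_stop_feasible_upper:
  assumes std: "s \<in> V" "t \<in> V" "d \<in> V" "s \<noteq> t" "t \<noteq> d" "s \<noteq> d"
    and feas: "must_stop_feasible V E c s t d r"
  shows "r \<le> max_flow (ext_verts V) (ext_edges E s d) (ext_cap c) (Some t) None / 2"
    and "r \<le> max_flow V E (\<lambda>e. ereal (c e)) s t"
    and "r \<le> max_flow V E (\<lambda>e. ereal (c e)) t d"
proof -
  let ?P = "paths V E s t" and ?Q = "paths V E t d"
  obtain x y where x: "\<And>p. p \<in> ?P \<Longrightarrow> 0 \<le> x p" "r \<le> sum x ?P"
    and y: "\<And>q. q \<in> ?Q \<Longrightarrow> 0 \<le> y q" "r \<le> sum y ?Q"
    and cap: "\<And>e. e \<in> E \<Longrightarrow> sum x {p \<in> ?P. e \<in> path_edges p} + sum y {q \<in> ?Q. e \<in> path_edges q} \<le> c e"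
    using feas unfolding must_stop_feasible_def by blast
  define X where "X = path_flow ?P x"
  define Y where "Y = path_flow ?Q y"
  have fin: "finite ?P" "finite ?Q"
    by (simp_all add: finite_paths finite_V)
  have X0: "0 \<le> X u v" and Y0: "0 \<le> Y u v" for u v
    using x(1) y(1) by (simp_all add: X_def Y_def path_flow_nonneg)
  have nonedge: "X u v = 0" "Y u v = 0" if "{u, v} \<notin> E" for u v
    using path_flow_nonedge[OF that] by (simp_all add: X_def Y_def)
  have XY: "X u v + X v u + (Y u v + Y v u) \<le> c {u, v}" if "{u, v} \<in> E" for u v
  proof -
    have "X u v + X v u \<le> sum x {p \<in> ?P. {u, v} \<in> path_edges p}"
      unfolding X_def by (rule path_flow_le_edge[OF fin(1) x(1)]) (simp_all add: paths_def)
    moreover have "Y u v + Y v u \<le> sum y {q \<in> ?Q. {u, v} \<in> path_edges q}"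
      unfolding Y_def by (rule path_flow_le_edge[OF fin(2) y(1)]) (simp_all add: paths_def)
    ultimately show ?thesis using cap[OF that] by linarith
  qed
  have inX: "inflow V (net X) v = sum x ?P * (of_bool (v = t) - of_bool (v = s))" for v
    unfolding X_def by (rule inflow_path_flow[OF finite_V \<open>s \<noteq> t\<close>])
  have inY: "inflow V (net Y) v = sum y ?Q * (of_bool (v = d) - of_bool (v = t))" for v
    unfolding Y_def by (rule inflow_path_flow[OF finite_V \<open>t \<noteq> d\<close>])
  \<comment> \<open>With the \<open>s\<close>-\<open>t\<close> part reversed, \<open>t\<close> sends
    to both \<open>s\<close> and \<open>d\<close>. The shared capacities do not see the direction,
    so the joint edge bound persists.\<close>
  define Z where "Z u v = Y u v + X v u" for u v
  have inZ: "inflow V (net Z) v = inflow V (net Y) v - inflow V (net X) v" for v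
    by (simp add: inflow_net Z_def sum.distrib)
  have nX: "netflow (net X)"
  proof (rule netflow_net)
    show "X u v + X v u \<le> c {u, v}" if "{u, v} \<in> E" for u v
      using XY[OF that] Y0[of u v] Y0[of v u] by linarith
  qed (use X0 nonedge in auto)
  have nY: "netflow (net Y)"
  proof (rule netflow_net)
    show "Y u v + Y v u \<le> c {u, v}" if "{u, v} \<in> E" for u v
      using XY[OF that] X0[of u v] X0[of v u] by linarith
  qed (use Y0 nonedge in auto)
  have nZ: "netflow (net Z)"
  proof (rule netflow_net)
    show "Z u v + Z v u \<le> c {u, v}" if "{u, v} \<in> E" for u v
      using XY[OF that] by (simp add: Z_def)
    show "Z u v = 0" if "{u, v} \<notin> E" for u v
      using nonedge[of u v] nonedge[of v u] that by (simp add: Z_def insert_commute)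
  qed (use X0 Y0 in \<open>simp add: Z_def\<close>)
  have "inflow V (net X) t \<le> max_flow V E (\<lambda>e. ereal (c e)) s t"
  proof (rule max_flow_netflow[OF \<open>s \<in> V\<close> \<open>t \<in> V\<close> \<open>s \<noteq> t\<close>])
    assume "\<And>g'. netflow g' \<Longrightarrow> (\<And>v. v \<in> V - {s, t} \<Longrightarrow> inflow V g' v = 0) \<Longrightarrow>
      inflow V g' t \<le> max_flow V E (\<lambda>e. ereal (c e)) s t"
    from this[OF nX] show ?thesis by (simp add: inX)
  qed
  then show "r \<le> max_flow V E (\<lambda>e. ereal (c e)) s t"
    using x(2) std by (simp add: inX)
  have "inflow V (net Y) d \<le> max_flow V E (\<lambda>e. ereal (c e)) t d"
  proof (rule max_flow_netflow[OF \<open>t \<in> V\<close> \<open>d \<in> V\<close> \<open>t \<noteq> d\<close>])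
    assume "\<And>g'. netflow g' \<Longrightarrow> (\<And>v. v \<in> V - {t, d} \<Longrightarrow> inflow V g' v = 0) \<Longrightarrow>
      inflow V g' d \<le> max_flow V E (\<lambda>e. ereal (c e)) t d"
    from this[OF nY] show ?thesis by (simp add: inY)
  qed
  then show "r \<le> max_flow V E (\<lambda>e. ereal (c e)) t d"
    using y(2) std by (simp add: inY)
  have "inflow V (net Z) s + inflow V (net Z) d \<le>
      max_flow (ext_verts V) (ext_edges E s d) (ext_cap c) (Some t) None"
  proof (rule max_flow_ext_netflow[OF std])
    assume "\<And>g'. netflow g' \<Longrightarrow> (\<And>v. v \<in> V - {s, t, d} \<Longrightarrow> inflow V g' v = 0) \<Longrightarrow>
      inflow V g' s + inflow V g' d \<le>
      max_flow (ext_verts V) (ext_edges E s d) (ext_cap c) (Some t) None"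
    from this[OF nZ] show ?thesis by (simp add: inX inY inZ)
  qed
  then show "r \<le> max_flow (ext_verts V) (ext_edges E s d) (ext_cap c) (Some t) None / 2"
    using x(2) y(2) std by (simp add: inX inY inZ)
qed

text \<open>Paths to \<open>s\<close> are split off first. The rest of the flow still delivers
  \<open>r\<close> to \<open>d\<close> and has nonnegative excess off \<open>t\<close>, so it
  decomposes again, and both families together stay below the positive part of
  \<open>g\<close>.\<close>

lemma must_stop_feasible_netflow:
  assumes std: "s \<in> V" "t \<in> V" "d \<in> V" "s \<noteq> t" "t \<noteq> d" "s \<noteq> d" and "0 \<le> r"
    and g: "netflow g" "\<And>v. v \<in> V - {s, t, d} \<Longrightarrow> inflow V g v = 0"
      "inflow V g s = r" "inflow V g d = r"
  shows "must_stop_feasible V E c s t d r"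
proof -
  let ?P = "paths V E t s" and ?Q = "paths V E t d"
  define f where "f u v = max 0 (g u v)" for u v
  have f: "0 \<le> f u v" "{u, v} \<notin> E \<Longrightarrow> f u v = 0" for u v
    using netflow_nonedge[OF g(1)] by (simp_all add: f_def)
  have net_f: "net f = g"
    unfolding f_def by (rule net_positive_part[OF netflow_skew[OF g(1)]])
  have in_ge: "0 \<le> inflow V g v" if "v \<in> V - {t}" for v
    using g that \<open>0 \<le> r\<close> by (cases "v \<in> {s, d}") auto
  obtain x where x: "\<And>p. 0 \<le> x p" "sum x ?P = r" "\<And>u v. path_flow ?P x u v \<le> f u v"
    using path_decomposition[of f t s r] f in_ge std \<open>0 \<le> r\<close> g(3) unfolding net_f by auto
  define f' where "f' u v = f u v - path_flow ?P x u v" for u v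
  have f'0: "0 \<le> f' u v" for u v
    using x(3)[of u v] by (simp add: f'_def)
  have f'_nonedge: "f' u v = 0" if "{u, v} \<notin> E" for u v
    using f(2)[OF that] path_flow_nonedge[OF that] by (simp add: f'_def)
  have in_f': "inflow V (net f') v = inflow V g v - r * (of_bool (v = s) - of_bool (v = t))" for v
    using inflow_path_flow[OF finite_V, of t s E x v] std x(2)
    by (simp add: f'_def[abs_def] net_diff inflow_diff net_f)
  have in_f'_ge: "0 \<le> inflow V (net f') v" if "v \<in> V - {t}" for v
    using in_ge[OF that] that g(3) by (auto simp: in_f')
  have "r \<le> inflow V (net f') d"
    using std g(4) by (simp add: in_f')
  then obtain y where y: "\<And>p. 0 \<le> y p" "sum y ?Q = r" "\<And>u v. path_flow ?Q y u v \<le> f' u v"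
    using path_decomposition[of f' t d r] f'0 f'_nonedge in_f'_ge std \<open>0 \<le> r\<close> by auto
  \<comment> \<open>The decomposition yields paths from \<open>t\<close> to \<open>s\<close>,
    whereas feasibility asks for paths from \<open>s\<close> to \<open>t\<close>; the weights are
    carried over by reversal. \<open>Q\<close> covers both the whole family and the paths through
    one edge.\<close>
  have rev_sum: "(\<Sum>p\<in>{p \<in> paths V E s t. Q (path_edges p)}. x (rev p)) =
      (\<Sum>p\<in>{p \<in> ?P. Q (path_edges p)}. x p)" for Q
  proof -
    have "{p \<in> ?P. Q (path_edges p)} = rev ` {p \<in> paths V E s t. Q (path_edges p)}"
      unfolding rev_paths[of V E s t, symmetric] by (auto simp: path_edges_rev)
    then show ?thesis by (simp add: sum.reindex)
  qed
  show ?thesis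
    unfolding must_stop_feasible_def
  proof (rule exI[of _ "\<lambda>p. x (rev p)"], rule exI[of _ y], intro conjI ballI)
    show "r \<le> (\<Sum>p\<in>paths V E s t. x (rev p))"
      using rev_sum[of "\<lambda>_. True"] x(2) by simp
    show "(\<Sum>p\<in>{p \<in> paths V E s t. e \<in> path_edges p}. x (rev p)) +
        (\<Sum>q\<in>{q \<in> ?Q. e \<in> path_edges q}. y q) \<le> c e" if "e \<in> E" for e
    proof -
      have "card e = 2" using graph that by (simp add: undirected_graph_def)
      then obtain u v where e: "e = {u, v}" by (auto simp: card_2_iff)
      have "sum x {p \<in> ?P. e \<in> path_edges p} \<le> path_flow ?P x u v + path_flow ?P x v u"
        unfolding e using x(1) by (intro path_flow_edge_le finite_paths finite_V)
      moreover have "sum y {q \<in> ?Q. e \<in> path_edges q} \<le> path_flow ?Q y u v + path_flow ?Q y v u"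
        unfolding e using y(1) by (intro path_flow_edge_le finite_paths finite_V)
      moreover have "f u v + f v u \<le> c e"
        using netflow_positive_part_cap[OF g(1), of u v] that by (simp add: e f_def)
      ultimately show ?thesis
        using y(3)[of u v] y(3)[of v u] rev_sum[of "\<lambda>E. e \<in> E"] by (simp add: f'_def)
    qed
  qed (use x(1) y in simp_all)
qed

end

section \<open>The minimum formula for the must-stop flow\<close>

theorem lemma3:
  fixes V :: "'v set" and E :: "'v set set" and c :: "'v set \<Rightarrow> real" and s t d :: 'v
  assumes "undirected_graph V E"
    and "\<forall>e\<in>E. 0 \<le> c e"
    and "s \<in> V" and "t \<in> V" and "d \<in> V"
    and "s \<noteq> t" and "t \<noteq> d" and "s \<noteq> d"
  shows "max_must_stop_flow V E c s t d =
         Min {max_flow (ext_verts V) (ext_edges E s d) (ext_cap c) (Some t) None / 2,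
              max_flow V E (\<lambda>e. ereal (c e)) s t,
              max_flow V E (\<lambda>e. ereal (c e)) t d}"
proof -
  interpret capacitated_graph V E c
    using assms(1,2) by unfold_locales auto
  note std = assms(3-8)
  let ?FT = "max_flow (ext_verts V) (ext_edges E s d) (ext_cap c) (Some t) None"
  let ?Fst = "max_flow V E (\<lambda>e. ereal (c e)) s t"
  let ?Ftd = "max_flow V E (\<lambda>e. ereal (c e)) t d"
  define r where "r = Min {?FT / 2, ?Fst, ?Ftd}"
  have zero_inflow: "inflow V (\<lambda>u v. 0) w = 0" for w
    by (simp add: inflow_def)
  \<comment> \<open>Nonnegativity of each maximum comes from comparison with the zero flow.\<close>
  obtain gT where gT: "netflow gT" "\<And>v. v \<in> V - {s, t, d} \<Longrightarrow> inflow V gT v = 0"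
    "inflow V gT s + inflow V gT d = ?FT" "0 \<le> ?FT"
    using max_flow_ext_netflow[OF std] netflow_0 zero_inflow by (metis add.right_neutral)
  obtain gs where gs: "netflow gs" "\<And>v. v \<in> V - {s, t} \<Longrightarrow> inflow V gs v = 0"
    "inflow V gs t = ?Fst" "0 \<le> ?Fst"
    using max_flow_netflow[OF std(1,2,4)] netflow_0 zero_inflow by metis
  obtain gd where gd: "netflow gd" "\<And>v. v \<in> V - {t, d} \<Longrightarrow> inflow V gd v = 0"
    "inflow V gd d = ?Ftd" "0 \<le> ?Ftd"
    using max_flow_netflow[OF std(2,3,5)] netflow_0 zero_inflow by metis
  have r: "0 \<le> r" "2 * r \<le> ?FT" "r \<le> ?Fst" "r \<le> ?Ftd"
    using gT(4) gs(4) gd(4) by (auto simp: r_def min_def)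
  \<comment> \<open>\<open>gs\<close> runs from \<open>s\<close> to \<open>t\<close>; its negation
    starts at \<open>t\<close> and delivers \<open>?Fst\<close> to \<open>s\<close>, as the two-sink
    construction expects.\<close>
  have "inflow V gs s = - ?Fst"
    using sum_inflow_terminals[of gs "{s, t}"] gs(1-3) std by (simp add: netflow_skew)
  then obtain g where g: "netflow g" "\<And>v. v \<in> V - {s, t, d} \<Longrightarrow> inflow V g v = 0"
    "inflow V g s = r" "inflow V g d = r"
    using two_sink_netflow[OF std r(1), of gT "\<lambda>u v. - gs u v" gd] gT gs gd r
    by (auto simp: netflow_minus inflow_minus)
  have "max_must_stop_flow V E c s t d = r"
    unfolding max_must_stop_flow_def
  proof (rule Greatest_equality)
    show "must_stop_feasible V E c s t d r"
      using must_stop_feasible_netflow[OF std r(1) g] .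
    show "r' \<le> r" if "must_stop_feasible V E c s t d r'" for r'
      using must_stop_feasible_upper[OF std that] by (simp add: r_def)
  qed
  then show ?thesis by (simp add: r_def)
qed

end
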